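(* Let $\mathcal H_n\subset\mathcal P_n$ be the $\mathbb Q$-span of the monomials $x_1^{i_1}\cdots x_n^{i_n}$ with $0\le i_k\le n-k$ (equivalently, of the Schubert polynomials $\mathfrak S_w$, $w\in S_n$). Then multiplication in $\mathcal P^\omega_n$ induces an isomorphism $\mathcal H_n\otimes_{\mathbb Q}\Lambda^\omega_n\cong\mathcal P^\omega_n$. In particular $\mathcal P^\omega_n$ is a free $\Lambda^\omega_n$-module of rank $n!$, and there is a canonical ring isomorphism $\mathrm{End}_{\Lambda^\omega_n}(\mathcal P^\omega_n)\cong\mathrm{Mat}(n!,\Lambda^\omega_n)$.
   Context: Let $\mathcal P_n=\mathbb Q[x_1,\dots,x_n]$. Let $\mathcal P^\omega_n=\mathbb Q[x_1,\dots,x_n]\otimes\bigwedge[\omega_1,\dots,\omega_n]$ ($\omega_i$ odd, commuting with the $x_j$), with $S_n$ acting by ring automorphisms via $s_i(x_j)=x_{s_i(j)}$, $s_i(\omega_j)=\omega_j+\delta_{ij}(x_j-x_{j+1})\omega_{j+1}$; the ring of extended symmetric polynomials is $\Lambda^\omega_n=(\mathcal P^\omega_n)^{S_n}$, a subring of $\mathcal P^\omega_n$. *)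

theory Defs
  imports Complex_Main "HOL-Library.Poly_Mapping"
begin

text \<open>Variables are indexed 0,...,n-1 (paper: 1,...,n).  A monomial of the
extended polynomial ring is a pair (a, S): the exponent vector a of the even
variables x_k and the set S of odd variables, standing for
x^a * omega_(s_1) * ... * omega_(s_r) with s_1 < ... < s_r listing S.
Elements of the ring are finitely supported rational combinations of monomials.\<close>

type_synonym emon = "(nat \<Rightarrow> nat) \<times> nat set"
type_synonym epoly = "emon \<Rightarrow>\<^sub>0 rat"

text \<open>Sign of reordering omega_S * omega_T into increasing order.\<close>
definition wsign :: "nat set \<Rightarrow> nat set \<Rightarrow> rat" where
  "wsign S T = (-1) ^ card {(i, j). i \<in> S \<and> j \<in> T \<and> j < i}"

definition mon_mult :: "emon \<Rightarrow> emon \<Rightarrow> rat \<times> emon" where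
  "mon_mult m m' =
     (if snd m \<inter> snd m' = {} then wsign (snd m) (snd m') else 0,
      (\<lambda>k. fst m k + fst m' k, snd m \<union> snd m'))"

definition emul :: "epoly \<Rightarrow> epoly \<Rightarrow> epoly" where
  "emul p q = (\<Sum>m\<in>Poly_Mapping.keys p. \<Sum>m'\<in>Poly_Mapping.keys q.
      Poly_Mapping.single (snd (mon_mult m m'))
        (Poly_Mapping.lookup p m * Poly_Mapping.lookup q m' * fst (mon_mult m m')))"

definition eone :: epoly where
  "eone = Poly_Mapping.single ((\<lambda>_. 0), {}) 1"

definition eX :: "nat \<Rightarrow> epoly" where
  "eX i = Poly_Mapping.single ((\<lambda>k. if k = i then 1 else 0), {}) 1"

definition eW :: "nat \<Rightarrow> epoly" where
  "eW i = Poly_Mapping.single ((\<lambda>_. 0), {i}) 1"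

definition xmon :: "(nat \<Rightarrow> nat) \<Rightarrow> epoly" where
  "xmon a = Poly_Mapping.single (a, {}) 1"

definition eprod_list :: "epoly list \<Rightarrow> epoly" where
  "eprod_list ps = foldr emul ps eone"

definition swp :: "nat \<Rightarrow> nat \<Rightarrow> nat" where
  "swp i k = (if k = i then i + 1 else if k = i + 1 then i else k)"

definition act_W :: "nat \<Rightarrow> nat \<Rightarrow> epoly" where
  "act_W i j = (if j = i then eW i + emul (eX i - eX (i + 1)) (eW (i + 1)) else eW j)"

text \<open>s_i on a monomial: the ring automorphism evaluated on generators.\<close>
definition act_mon :: "nat \<Rightarrow> emon \<Rightarrow> epoly" where
  "act_mon i m = emul (xmon (fst m \<circ> swp i))
      (eprod_list (map (act_W i) (sorted_list_of_set (snd m))))"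

definition act :: "nat \<Rightarrow> epoly \<Rightarrow> epoly" where
  "act i p = (\<Sum>m\<in>Poly_Mapping.keys p. Poly_Mapping.map (\<lambda>c. Poly_Mapping.lookup p m * c) (act_mon i m))"

definition Pw :: "nat \<Rightarrow> epoly set" where
  "Pw n = {p. \<forall>m\<in>Poly_Mapping.keys p. (\<forall>k\<ge>n. fst m k = 0) \<and> snd m \<subseteq> {..<n}}"

text \<open>Lambda^omega_n: S_n-invariants, S_n being generated by s_0..s_(n-2).\<close>
definition Lw :: "nat \<Rightarrow> epoly set" where
  "Lw n = {p \<in> Pw n. \<forall>i. i + 1 < n \<longrightarrow> act i p = p}"

text \<open>Staircase exponents: 0 \<le> a_k \<le> n-1-k for k < n (paper: 0 \<le> i_k \<le> n-k).\<close>
definition stair :: "nat \<Rightarrow> (nat \<Rightarrow> nat) set" where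
  "stair n = {a. \<forall>k. (k < n \<longrightarrow> a k \<le> n - 1 - k) \<and> (n \<le> k \<longrightarrow> a k = 0)}"

end

theory Submission
  imports Defs
begin

text \<open>The reflection s_i fixes every odd monomial, except that
\<open>s_i(\<omega>_S) = \<omega>_S + (x_i - x_(i+1)) \<omega>_(S - {i} \<union> {i+1})\<close> when \<open>i \<in> S\<close> and \<open>i + 1 \<notin> S\<close>.  Hence
\<open>p - s_i p\<close> is divisible by \<open>x_i - x_(i+1)\<close>, and divided differences act on the extended polynomials.
Let \<open>M_j\<close> be the invariants of the reflections \<open>s_i\<close> with \<open>j \<le> i\<close>, so that \<open>M_0\<close> is the ring of extended
symmetric polynomials and \<open>M_n\<close> is everything.  Each \<open>M_(j+1)\<close> is the direct sum of the
\<open>x_j^b M_j\<close> with \<open>b < n - j\<close>: for p in \<open>M_(j+1)\<close>, the Newton interpolation polynomial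
\<open>F(T) = \<Sum>a. (\<partial>_(j+a-1) \<dots> \<partial>_j p) (T - x_j) \<dots> (T - x_(j+a-1))\<close> has coefficients in \<open>M_j\<close> and satisfies
\<open>F(x_j) = p\<close>; conversely, a relation over \<open>M_j\<close> satisfied by \<open>x_j\<close> is, by symmetry, satisfied by the \<open>n - j\<close>
elements \<open>x_j, \<dots>, x_(n-1)\<close>, which exceeds its degree.  Iterating over j gives the staircase
monomials.\<close>

section \<open>Modules with divided differences\<close>

definition uexp :: "nat \<Rightarrow> nat \<Rightarrow> nat" where
  "uexp k = (\<lambda>l. if l = k then 1 else 0)"

lemma swp_swp [simp]: "swp i (swp i k) = k"
  by (auto simp: swp_def)

lemma uexp_swp: "uexp k \<circ> swp i = uexp (swp i k)"
  by (auto simp: uexp_def swp_def fun_eq_iff)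

text \<open>Removing one variable from a nonzero exponent lowers its total degree, so closure under
  all monomials reduces to closure under single variables.\<close>

lemma exponent_induct [consumes 1, case_names zero uexp]:
  fixes P :: "(nat \<Rightarrow> nat) \<Rightarrow> bool"
  assumes "\<And>k. n \<le> k \<Longrightarrow> a k = 0"
    and zero: "P (\<lambda>_. 0)"
    and uexp: "\<And>k b. k < n \<Longrightarrow> P b \<Longrightarrow> P (\<lambda>j. uexp k j + b j)"
  shows "P a"
  using assms(1)
proof (induction "sum a {..<n}" arbitrary: a)
  case 0
  then have "a = (\<lambda>_. 0)"
    by (auto simp: fun_eq_iff) (metis lessThan_iff not_le)
  then show ?case
    using zero by simp
next
  case (Suc N)
  then obtain k where k: "k < n" "a k > 0"
    by (metis lessThan_iff neq0_conv nat.distinct(1) sum.neutral)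
  define b where "b = a(k := a k - 1)"
  have a: "a = (\<lambda>j. uexp k j + b j)"
    using k by (auto simp: b_def uexp_def fun_eq_iff)
  have "sum a {..<n} = Suc (sum b {..<n})"
    unfolding a using k by (simp add: sum.distrib uexp_def)
  then have "P b"
    by (intro Suc.hyps(1)) (use Suc in \<open>auto simp: b_def\<close>)
  then show ?case
    unfolding a using k(1) by (intro uexp)
qed

text \<open>Views the extended polynomials as a module over the even ones with a twisted action of
  the reflections. The algebraic laws hold on the whole type; \<open>M\<close>, later
  \<open>Pw n\<close>, carries what depends on \<open>n\<close>.\<close>

locale demazure_module =
  fixes n :: nat and mon :: "(nat \<Rightarrow> nat) \<Rightarrow> 'm::ab_group_add \<Rightarrow> 'm"
    and s :: "nat \<Rightarrow> 'm \<Rightarrow> 'm" and M :: "'m set"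
  assumes mon_zero [simp]: "mon (\<lambda>_. 0) p = p"
    and mon_mon: "mon a (mon b p) = mon (\<lambda>k. a k + b k) p"
    and mon_add: "mon a (p + q) = mon a p + mon a q"
    and s_add: "s i (p + q) = s i p + s i q"
    and s_mon: "s i (mon a p) = mon (a \<circ> swp i) (s i p)"
    and s_s [simp]: "s i (s i p) = p"
    and s_comm: "Suc i < k \<Longrightarrow> s i (s k p) = s k (s i p)"
    and s_braid: "s i (s (Suc i) (s i p)) = s (Suc i) (s i (s (Suc i) p))"
    and torsion_free: "k \<noteq> l \<Longrightarrow> mon (uexp k) p = mon (uexp l) p \<Longrightarrow> p = 0"
    and M_zero: "0 \<in> M"
    and M_diff: "p \<in> M \<Longrightarrow> q \<in> M \<Longrightarrow> p - q \<in> M"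
    and M_X: "p \<in> M \<Longrightarrow> k < n \<Longrightarrow> mon (uexp k) p \<in> M"
    and divisible: "p \<in> M \<Longrightarrow> Suc i < n \<Longrightarrow>
      \<exists>q\<in>M. mon (uexp i) q - mon (uexp (Suc i)) q = p - s i p"
begin

abbreviation X :: "nat \<Rightarrow> 'm \<Rightarrow> 'm" where
  "X k \<equiv> mon (uexp k)"

lemma mon_0 [simp]: "mon a 0 = 0"
  using mon_add[of a 0 0] by simp

lemma s_0 [simp]: "s i 0 = 0"
  using s_add[of i 0 0] by simp

lemma mon_diff: "mon a (p - q) = mon a p - mon a q"
  by (metis add_diff_cancel_right' diff_add_cancel mon_add)

lemma s_diff: "s i (p - q) = s i p - s i q"
  by (metis add_diff_cancel_right' diff_add_cancel s_add)

lemma mon_sum: "mon a (sum f A) = (\<Sum>x\<in>A. mon a (f x))"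
  by (induction A rule: infinite_finite_induct) (auto simp: mon_add)

lemma X_comm: "X k (X l p) = X l (X k p)"
  by (simp add: mon_mon add.commute)

lemma s_X: "s i (X k p) = X (swp i k) (s i p)"
  by (simp add: s_mon uexp_swp)

text \<open>Cancellation of x_k - x_l; it makes divided differences unique.\<close>

lemma X_diff_inject:
  assumes "k \<noteq> l" "X k p - X l p = X k q - X l q"
  shows "p = q"
proof -
  have "X k (p - q) = X l (p - q)"
    using assms(2) by (simp add: mon_diff algebra_simps)
  then show ?thesis
    using torsion_free[OF assms(1)] by force
qed

lemma M_add: "p \<in> M \<Longrightarrow> q \<in> M \<Longrightarrow> p + q \<in> M"
  using M_diff[of p "0 - q"] M_diff[OF M_zero, of q] by simp

lemma sum_M: "(\<And>x. x \<in> A \<Longrightarrow> f x \<in> M) \<Longrightarrow> sum f A \<in> M"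
  by (induction A rule: infinite_finite_induct) (auto intro: M_add M_zero)

lemma mon_M:
  assumes "p \<in> M" "\<And>k. n \<le> k \<Longrightarrow> a k = 0"
  shows "mon a p \<in> M"
  using assms(2) by (induction a rule: exponent_induct) (auto simp: assms(1) simp flip: mon_mon intro: M_X)

section \<open>Divided differences and their invariance\<close>

definition dd :: "nat \<Rightarrow> 'm \<Rightarrow> 'm" where
  "dd i p = (SOME q. q \<in> M \<and> X i q - X (Suc i) q = p - s i p)"

lemma dd:
  assumes "p \<in> M" "Suc i < n"
  shows "dd i p \<in> M" "X i (dd i p) - X (Suc i) (dd i p) = p - s i p"
proof -
  have "dd i p \<in> M \<and> X i (dd i p) - X (Suc i) (dd i p) = p - s i p"
    unfolding dd_def by (rule someI_ex) (use divisible[OF assms] in blast)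
  then show "dd i p \<in> M" "X i (dd i p) - X (Suc i) (dd i p) = p - s i p"
    by auto
qed

text \<open>s_i negates both x_i - x_(i+1) and p - s_i p, so it fixes the quotient.\<close>

lemma s_dd:
  assumes "p \<in> M" "Suc i < n"
  shows "s i (dd i p) = dd i p"
proof (rule X_diff_inject)
  have "s i (X i (dd i p) - X (Suc i) (dd i p)) = s i (p - s i p)"
    using dd(2)[OF assms] by simp
  then have "X (Suc i) (s i (dd i p)) - X i (s i (dd i p)) = s i p - p"
    by (simp add: s_diff s_X swp_def)
  then have "X i (s i (dd i p)) - X (Suc i) (s i (dd i p)) = p - s i p"
    by (metis minus_diff_eq)
  then show "X i (s i (dd i p)) - X (Suc i) (s i (dd i p)) = X i (dd i p) - X (Suc i) (dd i p)"
    using dd(2)[OF assms] by simp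
qed simp

text \<open>s_k commutes with s_i and moves neither x_i nor x_(i+1), so it fixes divisor and
  dividend alike.\<close>

lemma s_dd_far:
  assumes "p \<in> M" "Suc i < n" "Suc i < k \<or> Suc k < i" "s k p = p"
  shows "s k (dd i p) = dd i p"
proof (rule X_diff_inject)
  have "s k (s i p) = s i p"
    using s_comm[of i k p] s_comm[of k i p] assms(3,4) by auto
  then have *: "s k (X i (dd i p) - X (Suc i) (dd i p)) = X i (dd i p) - X (Suc i) (dd i p)"
    using dd(2)[OF assms(1,2)] assms(4) by (simp add: s_diff)
  have "swp k i = i" "swp k (Suc i) = Suc i"
    using assms(3) by (auto simp: swp_def)
  with * show "X i (s k (dd i p)) - X (Suc i) (s k (dd i p)) = X i (dd i p) - X (Suc i) (dd i p)"
    by (simp add: s_diff s_X)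
qed simp

text \<open>An instance of the braid relation of divided differences: \<partial>_i \<partial>_(i+1)
  \<partial>_i u = \<partial>_(i+1) \<partial>_i \<partial>_(i+1) u = 0, since s_(i+1) fixes
  u.\<close>

lemma s_dd_dd:
  assumes u: "u \<in> M" "Suc (Suc i) < n" "s (Suc i) u = u"
  shows "s i (dd (Suc i) (dd i u)) = dd (Suc i) (dd i u)"
proof -
  define v where "v = dd i u"
  define w where "w = dd (Suc i) v"
  have v: "v \<in> M" "X i v - X (Suc i) v = u - s i u"
    using dd[of u i] u by (auto simp: v_def)
  have w: "X (Suc i) w - X (Suc (Suc i)) w = v - s (Suc i) v"
    using dd[of v "Suc i"] u v by (auto simp: w_def)
  \<comment> \<open>Under s_(i+1) the equation defining v becomes one for s_(i+1) v, with divisor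
    x_i - x_(i+2).\<close>
  have "s (Suc i) (X i v - X (Suc i) v) = s (Suc i) (u - s i u)"
    using v by simp
  then have v': "X i (s (Suc i) v) - X (Suc (Suc i)) (s (Suc i) v) = u - s (Suc i) (s i u)"
    by (simp add: s_diff s_X swp_def u)
  define d where "d k l p = X k p - X l p" for k l p
  have d_diff: "d k l (p - q) = d k l p - d k l q" for k l p q
    by (simp add: d_def mon_diff)
  have d_comm: "d k l (d k' l' p) = d k' l' (d k l p)" for k l k' l' p
    by (simp add: d_def mon_diff X_comm algebra_simps)
  have d_s: "s j (d k l p) = d (swp j k) (swp j l) (s j p)" for j k l p
    by (simp add: d_def s_diff s_X)
  have d_neg: "d k l p = - d l k p" for k l p
    by (simp add: d_def)
  have d_inject: "d k l p = d k l q \<Longrightarrow> k \<noteq> l \<Longrightarrow> p = q" for k l p q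
    unfolding d_def by (rule X_diff_inject)
  \<comment> \<open>Multiplied by the Vandermonde product of \<open>x_i, x_(i+1), x_(i+2)\<close>, w becomes an
    expression which \<open>s_i\<close> negates, by the braid relation.\<close>
  let ?E = "d (Suc i) (Suc (Suc i)) u - d i (Suc (Suc i)) (s i u) + d i (Suc i) (s (Suc i) (s i u))"
  let ?D = "\<lambda>w. d i (Suc i) (d i (Suc (Suc i)) (d (Suc i) (Suc (Suc i)) w))"
  have "?D w = d i (Suc i) (d i (Suc (Suc i)) v) - d i (Suc i) (d i (Suc (Suc i)) (s (Suc i) v))"
    using w by (simp add: d_def[of "Suc i"] d_diff)
  also have "d i (Suc i) (d i (Suc (Suc i)) v) = d i (Suc (Suc i)) (d i (Suc i) v)"
    by (rule d_comm)
  also have "d i (Suc i) v = u - s i u"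
    using v(2) by (simp add: d_def)
  also have "d i (Suc (Suc i)) (s (Suc i) v) = u - s (Suc i) (s i u)"
    using v' by (simp add: d_def)
  also have "d i (Suc (Suc i)) (u - s i u) - d i (Suc i) (u - s (Suc i) (s i u)) = ?E"
    by (simp add: d_def mon_diff)
  finally have E: "?D w = ?E" .
  \<comment> \<open>Hence s_i negates the last term of \<open>?E\<close>; it exchanges the other two
    with a change of sign.\<close>
  have br: "s i (s (Suc i) (s i u)) = s (Suc i) (s i u)"
    using s_braid[of i u] u by simp
  have "?D (s i w) = - s i (?D w)"
  proof -
    have "s i (?D w) = d (Suc i) i (d (Suc i) (Suc (Suc i)) (d i (Suc (Suc i)) (s i w)))"
      by (simp add: d_s swp_def)
    also have "\<dots> = - d i (Suc i) (d (Suc i) (Suc (Suc i)) (d i (Suc (Suc i)) (s i w)))"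
      by (rule d_neg)
    also have "d (Suc i) (Suc (Suc i)) (d i (Suc (Suc i)) (s i w)) =
        d i (Suc (Suc i)) (d (Suc i) (Suc (Suc i)) (s i w))"
      by (rule d_comm)
    finally show ?thesis by simp
  qed
  also have "\<dots> = - s i ?E"
    by (simp only: E)
  also have "s i ?E = - ?E"
    by (simp add: s_add s_diff d_s br swp_def d_neg[of "Suc i" i])
  finally have "?D (s i w) = ?D w"
    using E by simp
  then have "d i (Suc (Suc i)) (d (Suc i) (Suc (Suc i)) (s i w)) =
      d i (Suc (Suc i)) (d (Suc i) (Suc (Suc i)) w)"
    by (rule d_inject) simp
  then have "d (Suc i) (Suc (Suc i)) (s i w) = d (Suc i) (Suc (Suc i)) w"
    by (rule d_inject) simp
  then have "s i w = w"
    by (rule d_inject) simp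
  then show ?thesis
    by (simp add: v_def w_def)
qed

section \<open>Partial invariants and Newton coefficients\<close>

definition Inv :: "nat \<Rightarrow> 'm set" where
  "Inv j = {p \<in> M. \<forall>i. j \<le> i \<longrightarrow> Suc i < n \<longrightarrow> s i p = p}"

text \<open>For p in \<open>Inv (Suc j)\<close>, Newton's divided difference on the nodes x_j, ...,
  x_(j+a) of a function with value p at x_j; its values at the other nodes are images of p under the
  reflections.\<close>

primrec newton_coeff :: "nat \<Rightarrow> 'm \<Rightarrow> nat \<Rightarrow> 'm" where
  "newton_coeff j p 0 = p"
| "newton_coeff j p (Suc a) = dd (j + a) (newton_coeff j p a)"

lemma newton_coeff_M:
  assumes "p \<in> M" "j + a < n"
  shows "newton_coeff j p a \<in> M"
  using assms(2) by (induction a) (use assms in \<open>auto intro: dd\<close>)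

text \<open>A divided difference is symmetric in its nodes x_j, ..., x_(j+a) and stays invariant in
  the later variables; the excluded \<open>i = j + a\<close> mixes the last node with the first
  later variable.\<close>

lemma s_newton_coeff:
  assumes p: "p \<in> Inv (Suc j)"
  shows "j + a < n \<Longrightarrow> j \<le> i \<Longrightarrow> Suc i < n \<Longrightarrow> i \<noteq> j + a \<Longrightarrow>
    s i (newton_coeff j p a) = newton_coeff j p a"
proof (induction a arbitrary: i rule: less_induct)
  case (less a)
  have pM: "p \<in> M" using p by (simp add: Inv_def)
  show ?case
  proof (cases a)
    case 0
    then show ?thesis using p less.prems by (auto simp: Inv_def)
  next
    case (Suc b)
    have b: "newton_coeff j p b \<in> M" "Suc (j + b) < n"
      using newton_coeff_M[OF pM, of j b] less.prems Suc by auto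
    \<comment> \<open>The position of s_i relative to the outermost \<partial>_(j+b); i = j + b + 1
      is the excluded index j + a.\<close>
    consider "i = j + b" | "Suc i = j + b" | "Suc i < j + b" | "Suc (j + b) < i"
      using less.prems Suc by linarith
    then show ?thesis
    proof cases
      case 1
      then show ?thesis using Suc s_dd[OF b] by simp
    next
      case 2
      then obtain c where c: "b = Suc c" "i = j + c"
        using less.prems by (cases b) auto
      \<comment> \<open>\<open>s_dd_dd\<close> needs invariance two levels down, hence the complete
        induction.\<close>
      have "s (Suc i) (newton_coeff j p c) = newton_coeff j p c"
        by (rule less.IH) (use c Suc less.prems in auto)
      then show ?thesis
        using s_dd_dd[of "newton_coeff j p c" i] newton_coeff_M[OF pM, of j c] c Suc less.prems
        by simp
    next
      case 3
      then have "s i (newton_coeff j p b) = newton_coeff j p b"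
        by (intro less.IH) (use Suc less.prems in auto)
      with 3 Suc show ?thesis using s_dd_far[OF b] by simp
    next
      case 4
      then have "s i (newton_coeff j p b) = newton_coeff j p b"
        by (intro less.IH) (use Suc less.prems in auto)
      with 4 Suc show ?thesis using s_dd_far[OF b] by simp
    qed
  qed
qed

text \<open>Polynomials in T with coefficients in \<open>'m\<close> are lists, lowest coefficient first;
\<open>ev l\<close> substitutes \<open>x_l\<close> for T, and \<open>lin_step k d G\<close> is \<open>d + (T - x_k) G\<close>.\<close>

primrec ev :: "nat \<Rightarrow> 'm list \<Rightarrow> 'm" where
  "ev l [] = 0"
| "ev l (f # fs) = f + X l (ev l fs)"

primrec lin_step :: "nat \<Rightarrow> 'm \<Rightarrow> 'm list \<Rightarrow> 'm list" where
  "lin_step k d [] = [d]"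
| "lin_step k d (g # gs) = (d - X k g) # lin_step k g gs"

lemma ev_lin_step: "ev l (lin_step k d gs) = d + X l (ev l gs) - X k (ev l gs)"
proof (induction gs arbitrary: d)
  case Nil
  show ?case by simp
next
  case (Cons g gs)
  show ?case
    by (simp add: Cons.IH mon_add mon_diff X_comm[of k l] algebra_simps)
qed

lemma length_lin_step [simp]: "length (lin_step k d gs) = Suc (length gs)"
  by (induction gs arbitrary: d) auto

lemma map_s_lin_step:
  "map (s i) (lin_step k d gs) = lin_step (swp i k) (s i d) (map (s i) gs)"
  by (induction gs arbitrary: d) (auto simp: s_diff s_X)

text \<open>Makes the Newton polynomial invariant under \<open>s_k\<close>, \<open>l = k + 1\<close>: by the definition of \<open>d'\<close> as
the divided difference of d, the first argument on the left is \<open>s_k d\<close>.\<close>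

lemma lin_step_lin_step:
  "lin_step l (d - X k d' + X l d') (lin_step k d' gs) = lin_step k d (lin_step l d' gs)"
proof (induction gs arbitrary: d d')
  case Nil
  show ?case by simp
next
  case (Cons g gs)
  from Cons.IH[of "d' - X l g" g]
  have "lin_step l (d' - X k g) (lin_step k g gs) = lin_step k (d' - X l g) (lin_step l g gs)"
    by (simp add: algebra_simps)
  then show ?case
    by (simp add: mon_diff X_comm algebra_simps)
qed

lemma set_lin_step_M:
  "k < n \<Longrightarrow> d \<in> M \<Longrightarrow> set gs \<subseteq> M \<Longrightarrow> set (lin_step k d gs) \<subseteq> M"
  by (induction gs arbitrary: d) (auto intro: M_diff M_X)

text \<open>The nested form c_a + (T - x_(j+a)) (c_(a+1) + ...), with r coefficients from the a-th
  on. The whole Newton polynomial has a = 0 and r = n - j.\<close>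

primrec newton :: "nat \<Rightarrow> 'm \<Rightarrow> nat \<Rightarrow> nat \<Rightarrow> 'm list" where
  "newton j p 0 a = []"
| "newton j p (Suc r) a = lin_step (j + a) (newton_coeff j p a) (newton j p r (Suc a))"

lemma length_newton [simp]: "length (newton j p r a) = r"
  by (induction r arbitrary: a) auto

lemma set_newton_M:
  assumes "p \<in> M"
  shows "j + a + r \<le> n \<Longrightarrow> set (newton j p r a) \<subseteq> M"
proof (induction r arbitrary: a)
  case 0
  show ?case by simp
next
  case (Suc r)
  then have "set (newton j p r (Suc a)) \<subseteq> M" "newton_coeff j p a \<in> M"
    using newton_coeff_M[OF assms, of j a] by auto
  with Suc.prems show ?case
    using set_lin_step_M[of "j + a"] by simp
qed

text \<open>\<open>j + a + r = n\<close> makes the nodes run up to x_(n-1), and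
  \<open>Suc i \<noteq> j + a\<close> forbids exchanging the first node with its predecessor. So s_i
  exchanges two nodes or none; an exchange at the front is absorbed by
  \<open>lin_step_lin_step\<close>.\<close>

lemma map_s_newton:
  assumes p: "p \<in> Inv (Suc j)"
  shows "j + a + r = n \<Longrightarrow> j \<le> i \<Longrightarrow> Suc i < n \<Longrightarrow> Suc i \<noteq> j + a \<Longrightarrow>
    map (s i) (newton j p r a) = newton j p r a"
proof (induction r arbitrary: a rule: less_induct)
  case (less r)
  have pM: "p \<in> M" using p by (simp add: Inv_def)
  show ?case
  proof (cases r)
    case 0
    then show ?thesis by simp
  next
    case (Suc t)
    show ?thesis
    proof (cases "i = j + a")
      case False
      have "map (s i) (newton j p t (Suc a)) = newton j p t (Suc a)"
        by (rule less.IH) (use Suc False less.prems in auto)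
      moreover have "s i (newton_coeff j p a) = newton_coeff j p a"
        by (rule s_newton_coeff[OF p]) (use Suc False less.prems in auto)
      ultimately show ?thesis
        using Suc False less.prems by (auto simp: map_s_lin_step swp_def)
    next
      case True
      then obtain t' where t: "t = Suc t'"
        using Suc less.prems by (cases t) auto
      have 1: "map (s i) (newton j p t' (Suc (Suc a))) = newton j p t' (Suc (Suc a))"
        by (rule less.IH) (use Suc True t less.prems in auto)
      have 2: "s i (newton_coeff j p (Suc a)) = newton_coeff j p (Suc a)"
        by (rule s_newton_coeff[OF p]) (use Suc True t less.prems in auto)
      have 3: "s i (newton_coeff j p a) =
          newton_coeff j p a - X i (newton_coeff j p (Suc a)) + X (Suc i) (newton_coeff j p (Suc a))"
        using dd(2)[OF newton_coeff_M[OF pM, of j a], of i] True Suc less.prems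
        by (simp add: algebra_simps)
      show ?thesis
        using lin_step_lin_step[of "Suc i" "newton_coeff j p a" i "newton_coeff j p (Suc a)"
            "newton j p t' (Suc (Suc a))"] 2
          1 3
        unfolding Suc t by (simp add: map_s_lin_step swp_def True del: newton_coeff.simps)
    qed
  qed
qed

section \<open>Expansion in powers of x_j over the partial invariants: existence and
  uniqueness\<close>

lemma Inv_expansion:
  assumes "p \<in> Inv (Suc j)" "j < n"
  obtains fs where "length fs = n - j" "set fs \<subseteq> Inv j" "ev j fs = p"
proof
  let ?fs = "newton j p (n - j) 0"
  show "length ?fs = n - j" by simp
  show "set ?fs \<subseteq> Inv j"
  proof
    fix f assume f: "f \<in> set ?fs"
    have "f \<in> M"
      using f set_newton_M[of p j 0 "n - j"] assms by (auto simp: Inv_def)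
    moreover have "s i f = f" if "j \<le> i" "Suc i < n" for i
    proof -
      have "map (s i) ?fs = ?fs"
        using map_s_newton[OF assms(1), of 0 "n - j" i] that by simp
      then have "map (s i) ?fs = map (\<lambda>x. x) ?fs" by simp
      then show ?thesis
        using f by (simp only: map_eq_conv)
    qed
    ultimately show "f \<in> Inv j"
      by (simp add: Inv_def)
  qed
  \<comment> \<open>At T = x_j every term after the leading p contains the vanishing factor T - x_j;
    \<open>j < n\<close> ensures that the list is not empty.\<close>
  show "ev j ?fs = p"
    using assms(2) by (cases "n - j") (simp_all add: ev_lin_step)
qed

text \<open>The coefficients of the quotient \<open>(T F(T) - x_l F(x_l)) / (T - x_l)\<close> (synthetic division).\<close>

primrec suffix_evs :: "nat \<Rightarrow> 'm list \<Rightarrow> 'm list" where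
  "suffix_evs l [] = []"
| "suffix_evs l (f # fs) = ev l (f # fs) # suffix_evs l fs"

lemma length_suffix_evs [simp]: "length (suffix_evs l fs) = length fs"
  by (induction fs) auto

lemma ev_suffix_evs:
  "X l (ev l fs) - X k (ev k fs) = X l (ev l (suffix_evs k fs)) - X k (ev l (suffix_evs k fs))"
proof (induction fs)
  case Nil
  show ?case by simp
next
  case (Cons f fs)
  have "X l (X l (ev l fs) - X k (ev k fs)) =
      X l (X l (ev l (suffix_evs k fs)) - X k (ev l (suffix_evs k fs)))"
    by (simp only: Cons.IH)
  then show ?case
    by (simp add: mon_add mon_diff X_comm[of k l] algebra_simps)
qed

text \<open>From the top down: once the later coefficients vanish, a suffix value is its own first
  coefficient.\<close>

lemma suffix_evs_zero: "set (suffix_evs l fs) \<subseteq> {0} \<Longrightarrow> set fs \<subseteq> {0}"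
proof (induction fs)
  case (Cons f fs)
  then have "set fs \<subseteq> {0}" by simp
  moreover from this have "ev l fs = 0"
    by (induction fs) auto
  ultimately show ?case
    using Cons.prems by simp
qed simp

text \<open>Root counting. If F = f + T G vanishes at x_k and x_l, then x_l G(x_l) = x_k G(x_k); by
  torsion-freeness the quotient from synthetic division, with one coefficient fewer than F, vanishes
  at all nodes but x_k.\<close>

lemma ev_zero_imp_zero:
  "finite L \<Longrightarrow> length fs \<le> card L \<Longrightarrow> (\<And>l. l \<in> L \<Longrightarrow> ev l fs = 0) \<Longrightarrow> set fs \<subseteq> {0}"
proof (induction "length fs" arbitrary: fs L)
  case 0
  then show ?case by simp
next
  case (Suc m)
  then obtain f gs where fs: "fs = f # gs"
    by (cases fs) auto
  obtain k where k: "k \<in> L"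
    using Suc.prems Suc.hyps(2) by fastforce
  have "set (suffix_evs k gs) \<subseteq> {0}"
  proof (rule Suc.hyps(1))
    show "m = length (suffix_evs k gs)" "finite (L - {k})"
      using Suc fs by auto
    show "length (suffix_evs k gs) \<le> card (L - {k})"
      using Suc fs k by simp
    fix l assume l: "l \<in> L - {k}"
    then have "ev l fs = ev k fs"
      using Suc.prems k by simp
    then have "X l (ev l gs) = X k (ev k gs)"
      by (simp add: fs)
    then have "X l (ev l (suffix_evs k gs)) = X k (ev l (suffix_evs k gs))"
      using ev_suffix_evs[of l gs k] by simp
    then show "ev l (suffix_evs k gs) = 0"
      using torsion_free[of l k] l by blast
  qed
  then have gs: "set gs \<subseteq> {0}"
    by (rule suffix_evs_zero)
  then have "ev k gs = 0"
    by (induction gs) auto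
  then show ?case
    using gs Suc.prems(3)[OF k] fs by simp
qed

lemma s_ev: "s i (ev l fs) = ev (swp i l) (map (s i) fs)"
  by (induction fs) (auto simp: s_add s_X)

lemma Inv_expansion_unique:
  assumes fs: "set fs \<subseteq> Inv j" "length fs = n - j" and "ev j fs = 0"
  shows "set fs \<subseteq> {0}"
proof (rule ev_zero_imp_zero)
  show "finite {j..<n}" "length fs \<le> card {j..<n}"
    using fs by auto
  fix l assume "l \<in> {j..<n}"
  then have "j \<le> l" "l < n" by auto
  then show "ev l fs = 0"
  proof (induction l rule: dec_induct)
    case base
    show ?case by fact
  next
    case (step l)
    \<comment> \<open>s_l fixes the coefficients and carries x_l to x_(l+1), so each root yields the
      next.\<close>
    have "map (s l) fs = fs"
      using fs(1) step by (intro map_idI) (auto simp: Inv_def)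
    then have "ev (Suc l) fs = s l (ev l fs)"
      by (simp add: s_ev swp_def)
    then show ?case
      using step by simp
  qed
qed

text \<open>For i > j, s_i fixes x_j as well as the coefficients.\<close>

lemma ev_Inv:
  assumes "set fs \<subseteq> Inv j" "j < n"
  shows "ev j fs \<in> Inv (Suc j)"
  using assms(1)
proof (induction fs)
  case Nil
  show ?case by (simp add: Inv_def M_zero)
next
  case (Cons f fs)
  then show ?case
    using assms(2) by (auto simp: Inv_def s_add s_X swp_def intro: M_X M_add)
qed

section \<open>Staircase exponents in the variables from x_j on\<close>

definition stair_from :: "nat \<Rightarrow> (nat \<Rightarrow> nat) set" where
  "stair_from j = {a. \<forall>k. if j \<le> k \<and> k < n then a k < n - k else a k = 0}"

lemma stair_from_n: "stair_from n = {\<lambda>_. 0}"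
  by (auto simp: stair_from_def fun_eq_iff)

text \<open>Splits off the exponent of x_j, whose n - j values supply one factor of the factorial.
  It is 0 in \<open>stair_from (Suc j)\<close>, so overwriting it loses nothing.\<close>

lemma stair_from_upd:
  assumes "j < n"
  shows "bij_betw (\<lambda>(a, b). a(j := b)) (stair_from (Suc j) \<times> {..<n - j}) (stair_from j)"
proof (rule bij_betw_byWitness[where f' = "\<lambda>a. (a(j := 0), a j)"])
  have "a j = 0" if "a \<in> stair_from (Suc j)" for a
    using that unfolding stair_from_def by (auto dest: spec[of _ j])
  then show "\<forall>x\<in>stair_from (Suc j) \<times> {..<n - j}.
      (\<lambda>a. (a(j := 0), a j)) ((\<lambda>(a, b). a(j := b)) x) = x"
    by (auto simp: fun_upd_idem)
  show "(\<lambda>(a, b). a(j := b)) ` (stair_from (Suc j) \<times> {..<n - j}) \<subseteq> stair_from j"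
    using assms by (force simp: stair_from_def Suc_le_eq)
  show "(\<lambda>a. (a(j := 0), a j)) ` stair_from j \<subseteq> stair_from (Suc j) \<times> {..<n - j}"
    using assms by (force simp: stair_from_def Suc_le_eq split: if_splits)
qed simp

lemma finite_stair_from: "j \<le> n \<Longrightarrow> finite (stair_from j)"
proof (induction j rule: inc_induct)
  case base
  show ?case by (simp add: stair_from_n)
next
  case (step j)
  then show ?case
    using bij_betw_finite[OF stair_from_upd[of j]] by simp
qed

lemma card_stair_from: "j \<le> n \<Longrightarrow> card (stair_from j) = fact (n - j)"
proof (induction j rule: inc_induct)
  case base
  show ?case by (simp add: stair_from_n)
next
  case (step j)
  have "n - j = Suc (n - Suc j)" using step by simp
  then show ?case
    using bij_betw_same_card[OF stair_from_upd[of j]] step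
    by (simp add: card_cartesian_product algebra_simps)
qed

lemma ev_conv_sum: "ev l (map f [0..<m]) = (\<Sum>b<m. mon (\<lambda>k. if k = l then b else 0) (f b))"
proof (induction m arbitrary: f)
  case 0
  show ?case by simp
next
  case (Suc m)
  have "map f [0..<Suc m] = f 0 # map (\<lambda>b. f (Suc b)) [0..<m]"
    by (simp add: upt_conv_Cons map_Suc_upt[symmetric] del: upt_Suc)
  moreover have "(\<lambda>k. uexp l k + (if k = l then b else 0)) = (\<lambda>k. if k = l then Suc b else 0)" for b
    by (auto simp: uexp_def)
  ultimately show ?case
    by (simp add: Suc.IH mon_sum mon_mon sum.lessThan_Suc_shift del: sum.lessThan_Suc)
qed

section \<open>Linear combinations of staircase monomials\<close>

definition comb :: "nat \<Rightarrow> ((nat \<Rightarrow> nat) \<Rightarrow> 'm) \<Rightarrow> 'm" where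
  "comb j f = (\<Sum>a\<in>stair_from j. mon a (f a))"

text \<open>Collecting the terms with equal exponents of x_(j+1), ..., x_(n-1) leaves a polynomial
  in x_j, to which the one-step expansion applies.\<close>

lemma comb_Suc:
  assumes "j < n"
  shows "comb j f = comb (Suc j) (\<lambda>a. ev j (map (\<lambda>b. f (a(j := b))) [0..<n - j]))"
proof -
  have upd: "(\<lambda>k. a k + (if k = j then b else 0)) = a(j := b)" if "a \<in> stair_from (Suc j)" for a b
  proof -
    have "a j = 0"
      using that unfolding stair_from_def by (auto dest: spec[of _ j])
    then show ?thesis by auto
  qed
  have "comb j f = (\<Sum>(a, b)\<in>stair_from (Suc j) \<times> {..<n - j}. mon (a(j := b)) (f (a(j := b))))"
    unfolding comb_def sum.reindex_bij_betw[OF stair_from_upd[OF assms], symmetric]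
    by (simp add: case_prod_unfold)
  also have "\<dots> = comb (Suc j) (\<lambda>a. ev j (map (\<lambda>b. f (a(j := b))) [0..<n - j]))"
    unfolding comb_def sum.cartesian_product[symmetric] ev_conv_sum
    by (intro sum.cong) (simp_all add: mon_sum mon_mon upd)
  finally show ?thesis .
qed

text \<open>Descends from j = n, where \<open>Inv n\<close> is all of \<open>M\<close> and the only
  monomial is 1, expanding the coefficients in powers of x_j at each step.\<close>

lemma comb_ex:
  assumes "p \<in> M"
  shows "j \<le> n \<Longrightarrow> \<exists>f. (\<forall>a\<in>stair_from j. f a \<in> Inv j) \<and> comb j f = p"
proof (induction j rule: inc_induct)
  case base
  show ?case
    by (rule exI[of _ "\<lambda>_. p"]) (use assms in \<open>auto simp: stair_from_n comb_def Inv_def\<close>)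
next
  case (step j)
  then obtain f where f: "\<And>a. a \<in> stair_from (Suc j) \<Longrightarrow> f a \<in> Inv (Suc j)" "comb (Suc j) f = p"
    by blast
  have "\<exists>fs. length fs = n - j \<and> set fs \<subseteq> Inv j \<and> ev j fs = f a"
    if "a \<in> stair_from (Suc j)" for a
    using Inv_expansion[OF f(1)[OF that] step.hyps(2)] by metis
  then obtain F where F: "\<And>a. a \<in> stair_from (Suc j) \<Longrightarrow>
      length (F a) = n - j \<and> set (F a) \<subseteq> Inv j \<and> ev j (F a) = f a"
    by metis
  \<comment> \<open>Entry \<open>a j\<close> of the list that expands the coefficient of a with its
    x_j-exponent erased.\<close>
  define g where "g a = F (a(j := 0)) ! a j" for a
  have g: "map (\<lambda>b. g (a(j := b))) [0..<n - j] = F a" if "a \<in> stair_from (Suc j)" for a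
  proof -
    have "a j = 0"
      using that unfolding stair_from_def by (auto dest: spec[of _ j])
    then have "g (a(j := b)) = F a ! b" for b
      by (simp add: g_def fun_upd_idem)
    then show ?thesis
      using F[OF that] map_nth[of "F a"] by simp
  qed
  have "comb j g = p"
    unfolding comb_Suc[OF step.hyps(2)] f(2)[symmetric] unfolding comb_def
    by (intro sum.cong) (simp_all add: g F)
  moreover have "g a \<in> Inv j" if "a \<in> stair_from j" for a
  proof -
    from that have "(a(j := 0), a j) \<in> stair_from (Suc j) \<times> {..<n - j}"
      using step.hyps by (force simp: stair_from_def Suc_le_eq split: if_splits)
    then show ?thesis
      using F[of "a(j := 0)"] by (force simp: g_def)
  qed
  ultimately show ?case by blast
qed

text \<open>The inner polynomials of \<open>comb_Suc\<close> take values in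
  \<open>Inv (Suc j)\<close>, so they vanish by induction; then \<open>Inv_expansion_unique\<close>
  kills their coefficients.\<close>

lemma comb_unique:
  "j \<le> n \<Longrightarrow> (\<And>a. a \<in> stair_from j \<Longrightarrow> f a \<in> Inv j) \<Longrightarrow> comb j f = 0 \<Longrightarrow>
    a \<in> stair_from j \<Longrightarrow> f a = 0"
proof (induction j arbitrary: f a rule: inc_induct)
  case base
  then show ?case by (simp add: stair_from_n comb_def)
next
  case (step j)
  let ?l = "\<lambda>a. map (\<lambda>b. f (a(j := b))) [0..<n - j]"
  have upd: "a(j := b) \<in> stair_from j" if "a \<in> stair_from (Suc j)" "b < n - j" for a b
    using bij_betwE[OF stair_from_upd[OF step.hyps(2)]] that by fastforce
  have l: "set (?l a) \<subseteq> Inv j" if "a \<in> stair_from (Suc j)" for a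
    using step.prems(1) upd[OF that] by auto
  have a: "a(j := 0) \<in> stair_from (Suc j)" "a j < n - j"
    using step by (force simp: stair_from_def Suc_le_eq split: if_splits)+
  have "ev j (?l (a(j := 0))) = 0"
  proof (rule step.IH[OF _ _ a(1)])
    show "comb (Suc j) (\<lambda>a. ev j (?l a)) = 0"
      using step comb_Suc by simp
    fix a assume "a \<in> stair_from (Suc j)"
    then show "ev j (?l a) \<in> Inv (Suc j)"
      using ev_Inv[OF l] step.hyps(2) by blast
  qed
  then have "set (?l (a(j := 0))) \<subseteq> {0}"
    by (intro Inv_expansion_unique[OF l[OF a(1)]]) simp_all
  then have "f ((a(j := 0))(j := b)) = 0" if "b < n - j" for b
    using that by (simp add: image_subset_iff)
  from this[OF a(2)] show ?case by simp
qed

end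

section \<open>The extended polynomial ring\<close>

definition pm_extend :: "('a \<Rightarrow> 'b::comm_monoid_add \<Rightarrow> 'c::comm_monoid_add) \<Rightarrow> ('a \<Rightarrow>\<^sub>0 'b) \<Rightarrow> 'c" where
  "pm_extend g p = (\<Sum>m\<in>Poly_Mapping.keys p. g m (Poly_Mapping.lookup p m))"

lemma pm_extend_superset:
  assumes "\<And>m. g m 0 = 0" "finite A" "Poly_Mapping.keys p \<subseteq> A"
  shows "pm_extend g p = (\<Sum>m\<in>A. g m (Poly_Mapping.lookup p m))"
  unfolding pm_extend_def
  by (rule sum.mono_neutral_left) (use assms in \<open>auto simp: in_keys_iff\<close>)

lemma pm_extend_add:
  assumes "\<And>m. g m 0 = 0" "\<And>m c d. g m (c + d) = g m c + g m d"
  shows "pm_extend g (p + q) = pm_extend g p + pm_extend g q"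
proof -
  let ?A = "Poly_Mapping.keys p \<union> Poly_Mapping.keys q"
  have "pm_extend g r = (\<Sum>m\<in>?A. g m (Poly_Mapping.lookup r m))"
    if "r \<in> {p, q, p + q}" for r
    using that Poly_Mapping.keys_add[of p q] assms(1) by (intro pm_extend_superset) auto
  then show ?thesis
    by (simp add: lookup_add assms(2) sum.distrib)
qed

lemma pm_extend_single [simp]:
  "g m 0 = 0 \<Longrightarrow> pm_extend g (Poly_Mapping.single m c) = g m c"
  by (simp add: pm_extend_def)

lemma poly_mapping_sum_single:
  "(\<Sum>m\<in>Poly_Mapping.keys p. Poly_Mapping.single m (Poly_Mapping.lookup p m)) = p"
proof (rule poly_mapping_eqI)
  fix k
  have "Poly_Mapping.lookup (\<Sum>m\<in>Poly_Mapping.keys p. Poly_Mapping.single m (Poly_Mapping.lookup p m)) k =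
      (\<Sum>m\<in>Poly_Mapping.keys p. if m = k then Poly_Mapping.lookup p k else 0)"
    unfolding lookup_sum by (intro sum.cong) (auto simp: lookup_single)
  also have "\<dots> = Poly_Mapping.lookup p k"
    by (auto simp: in_keys_iff)
  finally show "Poly_Mapping.lookup (\<Sum>m\<in>Poly_Mapping.keys p.
      Poly_Mapping.single m (Poly_Mapping.lookup p m)) k = Poly_Mapping.lookup p k" .
qed

lemma poly_mapping_single_induct [case_names single add]:
  fixes P :: "('a \<Rightarrow>\<^sub>0 'b::comm_monoid_add) \<Rightarrow> bool"
  assumes single: "\<And>m c. P (Poly_Mapping.single m c)"
    and add: "\<And>p q. P p \<Longrightarrow> P q \<Longrightarrow> P (p + q)"
  shows "P p"
proof -
  have "P (\<Sum>m\<in>A. Poly_Mapping.single m (Poly_Mapping.lookup p m))" if "finite A" for A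
    using that by (induction A) (use single[of undefined 0] in \<open>auto intro: single add\<close>)
  from this[of "Poly_Mapping.keys p"] show ?thesis
    by (simp add: poly_mapping_sum_single)
qed

lemma poly_mapping_add_ext:
  fixes F G :: "('a \<Rightarrow>\<^sub>0 'b::comm_monoid_add) \<Rightarrow> 'c::plus"
  assumes "\<And>p q. F (p + q) = F p + F q" "\<And>p q. G (p + q) = G p + G q"
    and "\<And>m c. F (Poly_Mapping.single m c) = G (Poly_Mapping.single m c)"
  shows "F p = G p"
  by (induction p rule: poly_mapping_single_induct) (simp_all add: assms)

section \<open>Multiplication by even monomials and the ring product\<close>

definition xmul :: "(nat \<Rightarrow> nat) \<Rightarrow> epoly \<Rightarrow> epoly" where
  "xmul a = pm_extend (\<lambda>m. Poly_Mapping.single (\<lambda>k. a k + fst m k, snd m))"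

lemma xmul_add: "xmul a (p + q) = xmul a p + xmul a q"
  unfolding xmul_def by (rule pm_extend_add) (simp_all add: single_add)

lemma xmul_single [simp]:
  "xmul a (Poly_Mapping.single (b, S) c) = Poly_Mapping.single (\<lambda>k. a k + b k, S) c"
  by (simp add: xmul_def)

lemma xmul_zero [simp]: "xmul (\<lambda>_. 0) p = p"
  by (rule poly_mapping_add_ext) (auto simp: xmul_add)

lemma xmul_xmul: "xmul a (xmul b p) = xmul (\<lambda>k. a k + b k) p"
  by (rule poly_mapping_add_ext) (auto simp: xmul_add add.assoc)

lemma xmul_comm: "xmul a (xmul b p) = xmul b (xmul a p)"
  by (simp add: xmul_xmul add.commute)

lemma xmul_diff: "xmul a (p - q) = xmul a p - xmul a q"
  by (metis add_diff_cancel_right' diff_add_cancel xmul_add)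

lemma xmul_0 [simp]: "xmul a 0 = 0"
  using xmul_diff[of a 0 0] by simp

lemma lookup_xmul: "Poly_Mapping.lookup (xmul a p) (b, S) =
    (if \<forall>k. a k \<le> b k then Poly_Mapping.lookup p (\<lambda>k. b k - a k, S) else 0)"
proof (induction p rule: poly_mapping_single_induct)
  case (single m c)
  obtain d T where m: "m = (d, T)" by (cases m)
  have "a k + d k = b k \<longleftrightarrow> a k \<le> b k \<and> d k = b k - a k" for k
    by auto
  then have "(\<lambda>k. a k + d k) = b \<longleftrightarrow> (\<forall>k. a k \<le> b k) \<and> d = (\<lambda>k. b k - a k)"
    unfolding fun_eq_iff by simp blast
  then show ?case
    by (auto simp: m lookup_single when_def)
next
  case (add p q)
  then show ?case
    by (simp add: xmul_add lookup_add)
qed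

lemma wsign_empty [simp]: "wsign {} T = 1"
  by (simp add: wsign_def)

lemma emul_pm_extend: "emul p q = pm_extend (\<lambda>m c. pm_extend (\<lambda>m' c'.
    Poly_Mapping.single (snd (mon_mult m m')) (c * c' * fst (mon_mult m m'))) q) p"
  by (simp add: emul_def pm_extend_def)

lemma emul_add_left: "emul (p + p') q = emul p q + emul p' q"
  unfolding emul_pm_extend
  by (rule pm_extend_add)
    (simp_all add: pm_extend_def single_add ring_distribs sum.distrib)

lemma emul_add_right: "emul p (q + q') = emul p q + emul p q'"
  unfolding emul_pm_extend
  by (subst pm_extend_add) (simp_all add: single_add ring_distribs pm_extend_def sum.distrib)

lemma emul_diff_left: "emul (p - p') q = emul p q - emul p' q"
  by (metis add_diff_cancel_right' diff_add_cancel emul_add_left)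

lemma emul_diff_right: "emul p (q - q') = emul p q - emul p q'"
  by (metis add_diff_cancel_right' diff_add_cancel emul_add_right)

lemma emul_zero_right [simp]: "emul p 0 = 0"
  using emul_diff_right[of p 0 0] by simp

lemma emul_single: "emul (Poly_Mapping.single (a, S) c) (Poly_Mapping.single (b, T) d) =
    Poly_Mapping.single (\<lambda>k. a k + b k, S \<union> T) (if S \<inter> T = {} then c * d * wsign S T else 0)"
  by (simp add: emul_pm_extend mon_mult_def)

lemma emul_xmon: "emul (xmon a) p = xmul a p"
proof (rule poly_mapping_add_ext[where F = "emul (xmon a)" and G = "xmul a"])
  show "emul (xmon a) (Poly_Mapping.single m c) = xmul a (Poly_Mapping.single m c)" for m c
    by (cases m) (simp add: xmon_def emul_single)
qed (simp_all add: emul_add_right xmul_add)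

text \<open>Moving one index from i to i + 1 preserves the order of the remaining ones, so no signs
occur in the action of a reflection on odd monomials.\<close>

definition shiftable :: "nat \<Rightarrow> nat set \<Rightarrow> bool" where
  "shiftable i S \<longleftrightarrow> i \<in> S \<and> Suc i \<notin> S"

definition shift :: "nat \<Rightarrow> nat set \<Rightarrow> nat set" where
  "shift i S = insert (Suc i) (S - {i})"

definition wmon :: "nat set \<Rightarrow> rat \<Rightarrow> epoly" where
  "wmon S = Poly_Mapping.single (\<lambda>_. 0, S)"

lemma single_conv_xmul: "Poly_Mapping.single (a, S) c = xmul a (wmon S c)"
  by (simp add: wmon_def)

text \<open>If i and i + 1 both lie in S, the correction term would contain the square of
  \<omega>_(i+1), hence the restriction to shiftable sets.\<close>

definition refl_wmon :: "nat \<Rightarrow> nat set \<Rightarrow> rat \<Rightarrow> epoly" where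
  "refl_wmon i S c = wmon S c + (if shiftable i S
     then xmul (uexp i) (wmon (shift i S) c) - xmul (uexp (Suc i)) (wmon (shift i S) c) else 0)"

text \<open>Agrees with \<open>act i\<close> on \<open>Pw n\<close>, but obeys the reflection laws
  on the whole type, infinite odd index sets included.\<close>

definition refl_op :: "nat \<Rightarrow> epoly \<Rightarrow> epoly" where
  "refl_op i = pm_extend (\<lambda>m c. xmul (fst m \<circ> swp i) (refl_wmon i (snd m) c))"

lemma wmon_0 [simp]: "wmon S 0 = 0"
  by (simp add: wmon_def)

lemma wmon_add: "wmon S (c + d) = wmon S c + wmon S d"
  by (simp add: wmon_def single_add)

lemma refl_wmon_add: "refl_wmon i S (c + d) = refl_wmon i S c + refl_wmon i S d"
  by (simp add: refl_wmon_def wmon_add xmul_add)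

lemma refl_wmon_0 [simp]: "refl_wmon i S 0 = 0"
  by (simp add: refl_wmon_def)

lemma refl_op_add: "refl_op i (p + q) = refl_op i p + refl_op i q"
  unfolding refl_op_def by (rule pm_extend_add) (simp_all add: refl_wmon_add xmul_add)

lemma refl_op_diff: "refl_op i (p - q) = refl_op i p - refl_op i q"
  by (metis add_diff_cancel_right' diff_add_cancel refl_op_add)

lemma refl_op_0 [simp]: "refl_op i 0 = 0"
  using refl_op_diff[of i 0 0] by simp

lemma refl_op_single: "refl_op i (Poly_Mapping.single (a, S) c) = xmul (a \<circ> swp i) (refl_wmon i S c)"
  by (simp add: refl_op_def)

lemma refl_op_wmon: "refl_op i (wmon S c) = refl_wmon i S c"
  by (simp add: wmon_def refl_op_single comp_def)

lemma refl_op_xmul: "refl_op i (xmul a p) = xmul (a \<circ> swp i) (refl_op i p)"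
  by (rule poly_mapping_add_ext) (auto simp: xmul_add refl_op_add refl_op_single xmul_xmul comp_def)

text \<open>Reduces an identity of operators to odd monomials: both sides are additive and permute
  even exponents by the same \<open>\<pi>\<close>.\<close>

lemma epoly_add_ext:
  fixes F G :: "epoly \<Rightarrow> epoly" and \<pi> :: "(nat \<Rightarrow> nat) \<Rightarrow> nat \<Rightarrow> nat"
  assumes "\<And>p q. F (p + q) = F p + F q" "\<And>p q. G (p + q) = G p + G q"
    and "\<And>a p. F (xmul a p) = xmul (\<pi> a) (F p)" "\<And>a p. G (xmul a p) = xmul (\<pi> a) (G p)"
    and "\<And>S c. F (wmon S c) = G (wmon S c)"
  shows "F p = G p"
proof (rule poly_mapping_add_ext[OF assms(1,2)])
  show "F (Poly_Mapping.single m c) = G (Poly_Mapping.single m c)" for m c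
    using assms(3-5) by (cases m) (simp only: single_conv_xmul)
qed

section \<open>Relations between the reflections\<close>

lemma refl_op_refl_op: "refl_op i (refl_op i p) = p"
proof (rule epoly_add_ext[where F = "\<lambda>p. refl_op i (refl_op i p)" and G = "\<lambda>p. p"
      and \<pi> = "\<lambda>a. a"])
  \<comment> \<open>\<open>shift i S\<close> is not shiftable at i and s_i negates x_i - x_(i+1), so
    the two correction terms cancel.\<close>
  show "refl_op i (refl_op i (wmon S c)) = wmon S c" for S c
    by (simp add: refl_op_wmon refl_wmon_def refl_op_add refl_op_diff refl_op_xmul uexp_swp
        shiftable_def shift_def swp_def)
qed (simp_all add: refl_op_add refl_op_xmul comp_assoc comp_def[of "swp i" "swp i"] flip: id_def)

lemma refl_op_comm:
  assumes "Suc i < k"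
  shows "refl_op i (refl_op k p) = refl_op k (refl_op i p)"
proof (rule epoly_add_ext[where F = "\<lambda>p. refl_op i (refl_op k p)"
      and G = "\<lambda>p. refl_op k (refl_op i p)" and \<pi> = "\<lambda>a. a \<circ> swp k \<circ> swp i"])
  have [simp]: "swp i \<circ> swp k = swp k \<circ> swp i"
    using assms by (auto simp: fun_eq_iff swp_def)
  have sh: "shift i (shift k S) = shift k (shift i S)"
    "shiftable i (shift k S) = shiftable i S" "shiftable k (shift i S) = shiftable k S" for S
    using assms by (auto simp: shift_def shiftable_def)
  have sw: "swp i k = k" "swp i (Suc k) = Suc k" "swp k i = i" "swp k (Suc i) = Suc i"
    using assms by (auto simp: swp_def)
  show "refl_op i (refl_op k (wmon S c)) = refl_op k (refl_op i (wmon S c))" for S c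
    by (simp add: refl_op_wmon refl_wmon_def refl_op_add refl_op_diff refl_op_xmul uexp_swp
        sh sw xmul_add xmul_diff xmul_comm algebra_simps)
  show "refl_op k (refl_op i (xmul a p)) = xmul (a \<circ> swp k \<circ> swp i) (refl_op k (refl_op i p))" for a p
    by (simp add: refl_op_xmul comp_assoc)
qed (simp_all add: refl_op_add refl_op_xmul comp_assoc)

lemma refl_op_braid:
  "refl_op i (refl_op (Suc i) (refl_op i p)) = refl_op (Suc i) (refl_op i (refl_op (Suc i) p))"
proof (rule epoly_add_ext[where F = "\<lambda>p. refl_op i (refl_op (Suc i) (refl_op i p))"
      and G = "\<lambda>p. refl_op (Suc i) (refl_op i (refl_op (Suc i) p))"
      and \<pi> = "\<lambda>a. a \<circ> swp i \<circ> swp (Suc i) \<circ> swp i"])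
  have sw: "swp i \<circ> (swp (Suc i) \<circ> swp i) = swp (Suc i) \<circ> (swp i \<circ> swp (Suc i))"
    by (auto simp: fun_eq_iff swp_def)
  \<comment> \<open>Only the presence of i, i + 1 and i + 2 in S matters: eight patterns, each a
    computation.\<close>
  show "refl_op i (refl_op (Suc i) (refl_op i (wmon S c))) =
      refl_op (Suc i) (refl_op i (refl_op (Suc i) (wmon S c)))" for S c
    by (cases "i \<in> S"; cases "Suc i \<in> S"; cases "Suc (Suc i) \<in> S")
     (simp_all add: refl_op_wmon refl_wmon_def refl_op_add refl_op_diff refl_op_xmul uexp_swp
        shiftable_def shift_def swp_def xmul_add xmul_diff xmul_comm algebra_simps
        insert_Diff_if)
  show "refl_op (Suc i) (refl_op i (refl_op (Suc i) (xmul a p))) =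
      xmul (a \<circ> swp i \<circ> swp (Suc i) \<circ> swp i) (refl_op (Suc i) (refl_op i (refl_op (Suc i) p)))" for a p
    by (simp add: refl_op_xmul comp_assoc sw)
qed (simp_all add: refl_op_add refl_op_xmul comp_assoc)

text \<open>If N is the largest exponent of x_k in p, then x_k p has a monomial with exponent N + 1,
  while x_l p has none.\<close>

lemma xmul_torsion_free:
  assumes "k \<noteq> l" and eq: "xmul (uexp k) p = xmul (uexp l) p"
  shows "p = 0"
proof (rule ccontr)
  assume "p \<noteq> 0"
  then have ne: "Poly_Mapping.keys p \<noteq> {}" by simp
  define N where "N = Max ((\<lambda>m. fst m k) ` Poly_Mapping.keys p)"
  have "N \<in> (\<lambda>m. fst m k) ` Poly_Mapping.keys p"
    unfolding N_def using ne by (intro Max_in) auto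
  then obtain a S where m: "(a, S) \<in> Poly_Mapping.keys p" "N = a k"
    by auto
  define b where "b = a(k := Suc (a k))"
  have "Poly_Mapping.lookup (xmul (uexp k) p) (b, S) = Poly_Mapping.lookup p (a, S)"
  proof -
    have "(\<lambda>j. b j - uexp k j) = a" "\<forall>j. uexp k j \<le> b j"
      by (auto simp: b_def uexp_def fun_eq_iff)
    then show ?thesis by (simp add: lookup_xmul)
  qed
  moreover have "Poly_Mapping.lookup (xmul (uexp l) p) (b, S) = 0"
  proof -
    have "(\<lambda>j. b j - uexp l j, S) \<notin> Poly_Mapping.keys p"
    proof
      assume "(\<lambda>j. b j - uexp l j, S) \<in> Poly_Mapping.keys p"
      then have "b k - uexp l k \<le> N"
        unfolding N_def by (force intro!: Max_ge)
      then show False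
        using m assms(1) by (simp add: b_def uexp_def)
    qed
    then show ?thesis by (simp add: lookup_xmul in_keys_iff)
  qed
  ultimately show False
    using eq m by (simp add: in_keys_iff)
qed

section \<open>Extended polynomials in n variables; divisibility by x_i - x_(i+1)\<close>

lemma Pw_zero: "0 \<in> Pw n"
  by (simp add: Pw_def)

lemma Pw_add: "p \<in> Pw n \<Longrightarrow> q \<in> Pw n \<Longrightarrow> p + q \<in> Pw n"
  using Poly_Mapping.keys_add[of p q] unfolding Pw_def by blast

lemma Pw_diff: "p \<in> Pw n \<Longrightarrow> q \<in> Pw n \<Longrightarrow> p - q \<in> Pw n"
  using keys_diff[of p q] unfolding Pw_def by blast

lemma Pw_wmon: "S \<subseteq> {..<n} \<Longrightarrow> wmon S c \<in> Pw n"
  by (simp add: Pw_def wmon_def)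

lemma Pw_X:
  assumes "p \<in> Pw n" "k < n"
  shows "xmul (uexp k) p \<in> Pw n"
  unfolding Pw_def
proof clarify
  fix a S assume "(a, S) \<in> Poly_Mapping.keys (xmul (uexp k) p)"
  then have "(\<lambda>j. a j - uexp k j, S) \<in> Poly_Mapping.keys p" "\<forall>j. uexp k j \<le> a j"
    by (auto simp: in_keys_iff lookup_xmul split: if_splits)
  with assms have "(\<forall>j\<ge>n. a j - uexp k j = 0) \<and> S \<subseteq> {..<n}"
    unfolding Pw_def by force
  then show "(\<forall>j\<ge>n. fst (a, S) j = 0) \<and> snd (a, S) \<subseteq> {..<n}"
    using assms(2) by (auto simp: uexp_def)
qed

lemma Pw_induct [consumes 1, case_names wmon add X]:
  assumes "p \<in> Pw n"
    and wmon: "\<And>S c. S \<subseteq> {..<n} \<Longrightarrow> P (wmon S c)"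
    and add: "\<And>p q. p \<in> Pw n \<Longrightarrow> q \<in> Pw n \<Longrightarrow> P p \<Longrightarrow> P q \<Longrightarrow> P (p + q)"
    and X: "\<And>p k. p \<in> Pw n \<Longrightarrow> k < n \<Longrightarrow> P p \<Longrightarrow> P (xmul (uexp k) p)"
  shows "P p"
proof -
  have mon: "P (xmul a (wmon S c)) \<and> xmul a (wmon S c) \<in> Pw n"
    if "\<And>k. n \<le> k \<Longrightarrow> a k = 0" "S \<subseteq> {..<n}" for a S c
    using that(1)
    by (induction a rule: exponent_induct) (auto simp: wmon X that Pw_wmon Pw_X simp flip: xmul_xmul)
  have "(\<Sum>m\<in>A. Poly_Mapping.single m (Poly_Mapping.lookup p m)) \<in> Pw n \<and>
      P (\<Sum>m\<in>A. Poly_Mapping.single m (Poly_Mapping.lookup p m))"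
    if "finite A" "A \<subseteq> Poly_Mapping.keys p" for A
    using that
  proof (induction A)
    case empty
    then show ?case
      using wmon[of "{}" 0] by (simp add: Pw_zero)
  next
    case (insert m A)
    obtain a S where m: "m = (a, S)" by (cases m)
    have "\<And>k. n \<le> k \<Longrightarrow> a k = 0" "S \<subseteq> {..<n}"
      using assms(1) insert.prems m by (force simp: Pw_def)+
    from mon[OF this] insert show ?case
      using add by (simp add: m single_conv_xmul Pw_add)
  qed
  from this[of "Poly_Mapping.keys p"] show ?thesis
    by (simp add: poly_mapping_sum_single)
qed

lemma Pw_refl_op: "p \<in> Pw n \<Longrightarrow> Suc i < n \<Longrightarrow> refl_op i p \<in> Pw n"
proof (induction p rule: Pw_induct)
  case (wmon S c)
  then show ?case
    by (auto simp: refl_op_wmon refl_wmon_def shift_def intro!: Pw_add Pw_diff Pw_X Pw_wmon)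
qed (auto simp: refl_op_add refl_op_xmul uexp_swp swp_def intro!: Pw_add Pw_X)

lemma refl_op_divisible: "p \<in> Pw n \<Longrightarrow> Suc i < n \<Longrightarrow>
    \<exists>q\<in>Pw n. xmul (uexp i) q - xmul (uexp (Suc i)) q = p - refl_op i p"
proof (induction p rule: Pw_induct)
  case (wmon S c)
  have "shift i S \<subseteq> {..<n}"
    using wmon by (auto simp: shift_def)
  \<comment> \<open>The closed form of the reflection gives this quotient: p - s_i p is minus the
    correction term.\<close>
  then have "(if shiftable i S then - wmon (shift i S) c else 0) \<in> Pw n"
    using Pw_diff[OF Pw_zero[of n] Pw_wmon[of "shift i S" n c]] Pw_zero by auto
  then show ?case
    by (rule rev_bexI) (use xmul_diff[of _ 0] in \<open>auto simp: refl_op_wmon refl_wmon_def\<close>)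
next
  case (add p q)
  then obtain p' q' where
    "p' \<in> Pw n" "xmul (uexp i) p' - xmul (uexp (Suc i)) p' = p - refl_op i p"
    "q' \<in> Pw n" "xmul (uexp i) q' - xmul (uexp (Suc i)) q' = q - refl_op i q"
    by blast
  then show ?case
    by (intro bexI[of _ "p' + q'"] Pw_add) (simp_all add: xmul_add refl_op_add algebra_simps)
next
  case (X p k)
  then obtain q where q: "q \<in> Pw n" "xmul (uexp i) q - xmul (uexp (Suc i)) q = p - refl_op i p"
    by blast
  \<comment> \<open>The twisted Leibniz rule \<partial>_i (x_k p) = x_k \<partial>_i p +
    (\<partial>_i x_k) s_i p; \<epsilon> is its last term, \<partial>_i x_k being 1, -1 or
    0.\<close>
  define \<epsilon> where "\<epsilon> = (if k = i then refl_op i p else if k = Suc i then - refl_op i p else 0)"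
  have "\<epsilon> \<in> Pw n"
    using Pw_refl_op[OF X(1,4)] Pw_diff[OF Pw_zero, of "refl_op i p" n] Pw_zero
    by (auto simp: \<epsilon>_def)
  then have "xmul (uexp k) q + \<epsilon> \<in> Pw n"
    using q X by (intro Pw_add Pw_X)
  moreover have "xmul (uexp i) (xmul (uexp k) q + \<epsilon>) - xmul (uexp (Suc i)) (xmul (uexp k) q + \<epsilon>) =
      xmul (uexp k) p - refl_op i (xmul (uexp k) p)"
  proof -
    have "xmul (uexp i) (xmul (uexp k) q) - xmul (uexp (Suc i)) (xmul (uexp k) q) =
        xmul (uexp k) (xmul (uexp i) q - xmul (uexp (Suc i)) q)"
      by (simp add: xmul_diff xmul_xmul add.commute)
    also have "\<dots> = xmul (uexp k) p - xmul (uexp k) (refl_op i p)"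
      by (simp add: q xmul_diff)
    finally show ?thesis
      using xmul_diff[of _ 0 "refl_op i p"]
      by (auto simp: \<epsilon>_def xmul_add refl_op_xmul uexp_swp swp_def algebra_simps)
  qed
  ultimately show ?case by blast
qed

section \<open>Comparison with the action defined on generators\<close>

lemma act_W_eq: "act_W i j = refl_wmon i {j} 1"
proof -
  have "emul (eX k) (eW l) = xmul (uexp k) (wmon {l} 1)" for k l
    by (simp add: eX_def eW_def wmon_def emul_single uexp_def)
  then show ?thesis
    by (auto simp: act_W_def refl_wmon_def shiftable_def shift_def emul_diff_left eW_def
        simp flip: wmon_def)
qed

lemma emul_wmon_xmul:
  "emul (wmon S c) (xmul a (wmon T d)) =
    xmul a (wmon (S \<union> T) (if S \<inter> T = {} then c * d * wsign S T else 0))"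
  "emul (xmul a (wmon S c)) (wmon T d) =
    xmul a (wmon (S \<union> T) (if S \<inter> T = {} then c * d * wsign S T else 0))"
  "emul (wmon S c) (wmon T d) = wmon (S \<union> T) (if S \<inter> T = {} then c * d * wsign S T else 0)"
  by (simp_all add: wmon_def emul_single)

lemma wsign_eq_1:
  assumes "\<And>i j. i \<in> S \<Longrightarrow> j \<in> T \<Longrightarrow> i \<le> j"
  shows "wsign S T = 1"
proof -
  have "{(i, j). i \<in> S \<and> j \<in> T \<and> j < i} = {}"
    using assms by force
  then show ?thesis
    by (simp only: wsign_def card.empty power_0)
qed

text \<open>Peeling off the least index j keeps the factor from j leftmost, even after shifts, so
  each nonzero product has sign 1.\<close>

lemma eprod_list_act_W:
  "finite S \<Longrightarrow> eprod_list (map (act_W i) (sorted_list_of_set S)) = refl_wmon i S 1"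
proof (induction "card S" arbitrary: S)
  case 0
  then show ?case
    by (simp add: eprod_list_def eone_def refl_wmon_def shiftable_def wmon_def)
next
  case (Suc N)
  define j T where "j = Min S" and "T = S - {Min S}"
  have ne: "S \<noteq> {}" using Suc.hyps by auto
  have S: "S = insert j T" "j \<notin> T"
    using Min_in[OF Suc.prems ne] by (auto simp: j_def T_def)
  have less: "j < k" if "k \<in> T" for k
    using that ne Suc.prems by (auto simp: j_def T_def less_le)
  have "sorted_list_of_set S = j # sorted_list_of_set T"
    using ne Suc.prems by (simp add: j_def T_def sorted_list_of_set_nonempty)
  moreover have "eprod_list (map (act_W i) (sorted_list_of_set T)) = refl_wmon i T 1"
    by (rule Suc.hyps(1)) (use Suc.hyps Suc.prems S in auto)
  ultimately have "eprod_list (map (act_W i) (sorted_list_of_set S)) =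
      emul (refl_wmon i {j} 1) (refl_wmon i T 1)"
    by (simp add: eprod_list_def act_W_eq)
  also have "\<dots> = refl_wmon i S 1"
  proof (cases "j = i")
    case True
    \<comment> \<open>The correction comes from the head; when T contains i + 1 it is annihilated,
      matching \<open>shiftable\<close>.\<close>
    have "wsign {i} T = 1" "wsign {Suc i} T = 1"
      using less True by (auto intro!: wsign_eq_1 simp: Suc_le_eq less_imp_le)
    moreover have "i \<notin> T" "S - {i} = T"
      using S True by auto
    ultimately show ?thesis
      using S by (auto simp: True refl_wmon_def shiftable_def shift_def emul_add_left
          emul_diff_left emul_wmon_xmul)
  next
    case False
    \<comment> \<open>The head is fixed and the correction comes from T; i in T forces j < i, so j
      cannot be i + 1.\<close>
    have "wsign {j} T = 1"
      using less by (auto intro!: wsign_eq_1 less_imp_le)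
    moreover have "wsign {j} (shift i T) = 1 \<and> j \<notin> shift i T \<and> insert j (shift i T) = shift i S" if "i \<in> T"
      using less that less_SucI[OF less[OF that]] False S by (auto intro!: wsign_eq_1 simp: shift_def less_imp_le)
    moreover have "shiftable i S \<longleftrightarrow> shiftable i T"
      using S less[of i] False by (auto simp: shiftable_def)
    ultimately show ?thesis
      using S False by (auto simp: refl_wmon_def shiftable_def emul_add_right
          emul_diff_right emul_wmon_xmul)
  qed
  finally show ?case .
qed

lemma act_eq_refl_op:
  assumes "p \<in> Pw n"
  shows "act i p = refl_op i p"
proof -
  have scale_add: "Poly_Mapping.map ((*) c) (q + r) = Poly_Mapping.map ((*) c) q + Poly_Mapping.map ((*) c) r"
    for c :: rat and q r :: epoly
    by (rule poly_mapping_eqI)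
      (auto simp: lookup_add map.rep_eq when_def distrib_left simp flip: distrib_left)
  have scale_diff: "Poly_Mapping.map ((*) c) (q - r) = Poly_Mapping.map ((*) c) q - Poly_Mapping.map ((*) c) r"
    for c :: rat and q r :: epoly
    by (metis add_diff_cancel_right' diff_add_cancel scale_add)
  have scale: "Poly_Mapping.map ((*) c) (xmul a (refl_wmon i S 1)) = xmul a (refl_wmon i S c)" for a S c
    using scale_diff[of c 0 0]
    by (auto simp: refl_wmon_def xmul_add xmul_diff wmon_def scale_add scale_diff)
  have "Poly_Mapping.map ((*) c) (act_mon i m) = xmul (fst m \<circ> swp i) (refl_wmon i (snd m) c)"
    if "m \<in> Poly_Mapping.keys p" for m c
  proof -
    \<comment> \<open>\<open>sorted_list_of_set\<close> lists only finite sets faithfully; on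
      infinite ones it is empty.\<close>
    have "finite (snd m)"
      using that assms by (auto simp: Pw_def intro: finite_subset)
    then show ?thesis
      by (simp add: act_mon_def eprod_list_act_W emul_xmon scale)
  qed
  then show ?thesis
    unfolding act_def refl_op_def pm_extend_def by (intro sum.cong) simp_all
qed

lemma demazure_module_Pw: "demazure_module n xmul refl_op (Pw n)"
  by unfold_locales
    (fact xmul_zero xmul_xmul xmul_add refl_op_add refl_op_xmul refl_op_refl_op refl_op_comm
      refl_op_braid xmul_torsion_free Pw_zero Pw_diff Pw_X refl_op_divisible)+

section \<open>The staircase basis over the extended symmetric polynomials\<close>

theorem theorem3p1:
  fixes n :: nat
  shows "finite (stair n) \<and> card (stair n) = fact n \<and>
    bij_betw (\<lambda>f. \<Sum>a\<in>stair n. emul (xmon a) (f a))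
      {f. (\<forall>a\<in>stair n. f a \<in> Lw n) \<and> (\<forall>a. a \<notin> stair n \<longrightarrow> f a = 0)}
      (Pw n)"
proof -
  interpret demazure_module n xmul refl_op "Pw n"
    by (rule demazure_module_Pw)
  have stair: "stair n = stair_from 0"
    by (force simp: stair_def stair_from_def)
  have Lw: "Lw n = Inv 0"
    by (auto simp: Lw_def Inv_def act_eq_refl_op)
  have Inv_diff: "p - q \<in> Inv 0" if "p \<in> Inv 0" "q \<in> Inv 0" for p q
    using that by (auto simp: Inv_def s_diff M_diff)
  have "bij_betw (comb 0)
      {f. (\<forall>a\<in>stair n. f a \<in> Lw n) \<and> (\<forall>a. a \<notin> stair n \<longrightarrow> f a = 0)} (Pw n)"
    (is "bij_betw _ ?F _")
  proof (rule bij_betw_imageI)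
    show "inj_on (comb 0) ?F"
    proof (rule inj_onI)
      fix f g assume f: "f \<in> ?F" and g: "g \<in> ?F" and eq: "comb 0 f = comb 0 g"
      \<comment> \<open>By additivity of \<open>comb 0\<close>, the difference is a relation with
        invariant coefficients.\<close>
      have "f a - g a = 0" if "a \<in> stair_from 0" for a
      proof (rule comb_unique[of 0 "\<lambda>a. f a - g a"])
        show "f a - g a \<in> Inv 0" if "a \<in> stair_from 0" for a
          using that f g by (intro Inv_diff) (auto simp: stair Lw)
        show "comb 0 (\<lambda>a. f a - g a) = 0"
          using eq by (simp add: comb_def mon_diff sum_subtractf)
      qed (simp_all add: that)
      moreover have "f a = 0 \<and> g a = 0" if "a \<notin> stair n" for a
        using f g that by blast
      ultimately show "f = g"
        unfolding stair by (metis ext eq_iff_diff_eq_0)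
    qed
    show "comb 0 ` ?F = Pw n"
    proof (intro equalityI subsetI)
      fix p assume "p \<in> Pw n"
      then obtain f where f: "\<forall>a\<in>stair_from 0. f a \<in> Inv 0" "comb 0 f = p"
        using comb_ex[of p 0] by blast
      \<comment> \<open>\<open>comb_ex\<close> leaves the values off the staircase open; the domain
        demands 0 there.\<close>
      let ?g = "\<lambda>a. if a \<in> stair_from 0 then f a else 0"
      have "comb 0 ?g = p"
        using f(2) by (simp add: comb_def)
      then show "p \<in> comb 0 ` ?F"
        using f(1) by (intro image_eqI[of _ _ ?g]) (simp_all add: stair Lw)
    next
      fix p assume "p \<in> comb 0 ` ?F"
      then obtain f where f: "f \<in> ?F" "p = comb 0 f" by blast
      have "xmul a (f a) \<in> Pw n" if "a \<in> stair n" for a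
        using f that by (intro mon_M) (auto simp: Lw_def stair_def)
      then show "p \<in> Pw n"
        unfolding f(2) comb_def stair[symmetric] by (intro sum_M)
    qed
  qed
  moreover have "comb 0 = (\<lambda>f. \<Sum>a\<in>stair n. emul (xmon a) (f a))"
    by (simp add: comb_def stair emul_xmon fun_eq_iff)
  ultimately show ?thesis
    using finite_stair_from[of 0] card_stair_from[of 0] by (simp add: stair)
qed

end
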